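(* For $n\ge 1$, \[N_{n+1}(q)=\sum_{k=0}^{n}q^{\binom{k+1}{2}}\sum_{\pi\in S_n}q^{a_k(\pi)}q^{\operatorname{ninvsum}(\pi)} =N_n(q)+\sum_{k=1}^{n-1}q^{\binom{k+1}{2}}\sum_{\pi\in S_n}q^{z_k(\pi)}q^{\operatorname{ninvsum}(\pi)}+q^{\binom{n+1}{2}}N_n(q),\] where $\binom{1}{2}=0$.
   Context: $S_n$ is the set of permutations of $\{1,\dots,n\}$. A non-inversion of $\pi$ is a pair $(a,b)$ with $1\le a<b\le n$ and $\pi(a)<\pi(b)$; $\operatorname{ninvsum}(\pi)$ is the sum of $b-a$ over all non-inversions. $N_n(q)=\sum_{\pi\in S_n}q^{\operatorname{ninvsum}(\pi)}$. For $1\le k\le n-1$, $z_k(\pi)$ is the number of non-inversions $(a,b)$ of $\pi$ with $a\le k<b$; the augmented non-inversion zone-crossing vector is $(a_0(\pi),\dots,a_n(\pi))=(0,z_1(\pi),\dots,z_{n-1}(\pi),0)$. *)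

theory Defs
  imports "HOL-Computational_Algebra.Polynomial" "HOL-Combinatorics.Permutations"
begin

(* The symmetric group on {1..n}: permutations are functions on nat that fix
   everything outside {1..n}, so each permutation is represented exactly once. *)
definition Sn :: "nat \<Rightarrow> (nat \<Rightarrow> nat) set" where
  "Sn n = {\<pi>. \<pi> permutes {1..n}}"

definition noninversions :: "nat \<Rightarrow> (nat \<Rightarrow> nat) \<Rightarrow> (nat \<times> nat) set" where
  "noninversions n \<pi> = {(a, b). 1 \<le> a \<and> a < b \<and> b \<le> n \<and> \<pi> a < \<pi> b}"

(* The subtraction on nat is exact, as a < b for every non-inversion (a, b). *)
definition ninvsum :: "nat \<Rightarrow> (nat \<Rightarrow> nat) \<Rightarrow> nat" where
  "ninvsum n \<pi> = (\<Sum>(a, b) \<in> noninversions n \<pi>. b - a)"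

definition zone_crossing :: "nat \<Rightarrow> (nat \<Rightarrow> nat) \<Rightarrow> nat \<Rightarrow> nat" where
  "zone_crossing n \<pi> k = card {(a, b) \<in> noninversions n \<pi>. a \<le> k \<and> k < b}"

(* Entry k of the augmented non-inversion zone-crossing vector, for 0 \<le> k \<le> n;
   the two entries k = 0 and k = n are 0. *)
definition aug_zone_crossing :: "nat \<Rightarrow> (nat \<Rightarrow> nat) \<Rightarrow> nat \<Rightarrow> nat" where
  "aug_zone_crossing n \<pi> k =
     (if 1 \<le> k \<and> k \<le> n - 1 then zone_crossing n \<pi> k else 0)"

(* The indeterminate q of the polynomial ring over the integers. *)
abbreviation qvar :: "int poly" where
  "qvar \<equiv> [:0, 1:]"

definition ninvsum_poly :: "nat \<Rightarrow> int poly" where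
  "ninvsum_poly n = (\<Sum>\<pi> \<in> Sn n. qvar ^ ninvsum n \<pi>)"

end

theory Submission
  imports Defs
begin

text \<open>
  Every permutation of \<open>{1..n+1}\<close> arises exactly once by inserting the letter \<open>n + 1\<close> at
  position \<open>k + 1\<close>, with \<open>0 \<le> k \<le> n\<close>, into the one-line notation of some \<open>\<pi>\<close> in \<open>S\<^sub>n\<close>. The new
  letter forms a non-inversion with each of the \<open>k\<close> positions to its left, and these contribute
  \<open>1 + \<dots> + k\<close>; an old non-inversion keeps its length unless it straddles the insertion point,
  in which case it grows by one.
\<close>

text \<open>For \<open>k \<le> n\<close> this is a permutation of the positions
  \<open>{1..n + 1}\<close>, so insertion becomes plain composition. Position \<open>k + 1\<close>
  goes to \<open>n + 1\<close>, a fixed point of every member of \<open>Sn n\<close>, and this is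
  how the new letter appears there. Later positions move back by one.\<close>

definition remove_pos :: "nat \<Rightarrow> nat \<Rightarrow> nat \<Rightarrow> nat" where
  "remove_pos n k i = (if i = k + 1 then n + 1 else if k + 1 < i \<and> i \<le> n + 1 then i - 1 else i)"

definition insert_max :: "nat \<Rightarrow> nat \<Rightarrow> (nat \<Rightarrow> nat) \<Rightarrow> nat \<Rightarrow> nat" where
  "insert_max n k \<pi> = \<pi> \<circ> remove_pos n k"

text \<open>New position of the letter formerly at position \<open>i\<close>. On
  \<open>{1..n}\<close> it is a right inverse of \<open>remove_pos n k\<close>, and its values avoid
  \<open>k + 1\<close>.\<close>

definition skip_pos :: "nat \<Rightarrow> nat \<Rightarrow> nat" where
  "skip_pos k i = (if i \<le> k then i else i + 1)"

lemma skip_pos_less_iff: "skip_pos k a < skip_pos k b \<longleftrightarrow> a < b"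
  by (auto simp: skip_pos_def)

lemma inj_skip_pos: "inj (skip_pos k)"
  by (auto simp: inj_def skip_pos_def split: if_splits)

lemma skip_pos_diff:
  assumes "a < b"
  shows "skip_pos k b - skip_pos k a = (b - a) + (if a \<le> k \<and> k < b then 1 else 0)"
  using assms by (auto simp: skip_pos_def)

lemma skip_pos_cases:
  assumes "i \<in> {1..n + 1}" "k \<le> n"
  obtains "i = k + 1" | j where "j \<in> {1..n}" "i = skip_pos k j"
proof -
  consider "i = k + 1" | "i \<le> k" | "i > k + 1" by linarith
  then show thesis
  proof cases
    case 2
    then show thesis using assms that(2)[of i] by (auto simp: skip_pos_def)
  next
    case 3
    then obtain j where "i = j + 1" "j > k" by (cases i) auto
    then show thesis using assms that(2)[of j] by (auto simp: skip_pos_def)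
  qed (use that in blast)
qed

lemma remove_pos_permutes:
  assumes "k \<le> n"
  shows "remove_pos n k permutes {1..n + 1}"
proof (rule inj_imp_permutes)
  show "inj_on (remove_pos n k) {1..n + 1}"
    using assms by (auto simp: inj_on_def remove_pos_def split: if_splits)
qed (use assms in \<open>auto simp: remove_pos_def\<close>)

lemma insert_max_permutes:
  assumes "\<pi> permutes {1..n}" "k \<le> n"
  shows "insert_max n k \<pi> permutes {1..n + 1}"
  unfolding insert_max_def
  by (rule permutes_compose[OF remove_pos_permutes permutes_subset]) (use assms in auto)

lemma insert_max_skip_pos:
  assumes "j \<in> {1..n}"
  shows "insert_max n k \<pi> (skip_pos k j) = \<pi> j"
  using assms by (auto simp: insert_max_def remove_pos_def skip_pos_def)

lemma insert_max_new:
  assumes "\<pi> permutes {1..n}"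
  shows "insert_max n k \<pi> (k + 1) = n + 1"
  using permutes_not_in[OF assms, of "n + 1"] by (simp add: insert_max_def remove_pos_def)

text \<open>The insertion point can be read off as the only position carrying \<open>n + 1\<close>.
  Once both insertion points agree, the common surjective factor \<open>remove_pos n k\<close>
  cancels on the right.\<close>

lemma inj_on_insert_max: "inj_on (\<lambda>(k, \<pi>). insert_max n k \<pi>) ({0..n} \<times> Sn n)"
proof (rule inj_onI, clarsimp simp: Sn_def)
  fix k \<pi> l \<rho>
  assume *: "k \<le> n" "l \<le> n" "\<pi> permutes {Suc 0..n}" "\<rho> permutes {Suc 0..n}"
    and eq: "insert_max n k \<pi> = insert_max n l \<rho>"
  have "insert_max n k \<pi> (k + 1) = insert_max n k \<pi> (l + 1)"
    using insert_max_new[of \<pi> n k] insert_max_new[of \<rho> n l] * eq by simp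
  moreover have "inj (insert_max n k \<pi>)"
    using insert_max_permutes[of \<pi> n k] * by (auto intro: permutes_inj)
  ultimately have "k = l" by (auto dest: injD)
  moreover have "surj (remove_pos n k)"
    using *(1) by (intro permutes_surj[OF remove_pos_permutes])
  ultimately show "k = l \<and> \<pi> = \<rho>"
    using eq unfolding insert_max_def by (metis comp_assoc comp_id surj_iff)
qed

text \<open>Surjectivity comes from counting: the injective image lies in \<open>Sn (n + 1)\<close>
  and has (n+1) * n! = (n+1)! elements.\<close>

lemma bij_betw_insert_max:
  "bij_betw (\<lambda>(k, \<pi>). insert_max n k \<pi>) ({0..n} \<times> Sn n) (Sn (n + 1))"
proof -
  let ?f = "\<lambda>(k, \<pi>). insert_max n k \<pi>"
  have fin: "finite (Sn m)" and card: "card (Sn m) = fact m" for m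
    using finite_permutations[of "{1..m}"] card_permutations[of "{1..m}" m]
    by (auto simp: Sn_def)
  have "?f ` ({0..n} \<times> Sn n) = Sn (n + 1)"
  proof (rule card_subset_eq)
    show "?f ` ({0..n} \<times> Sn n) \<subseteq> Sn (n + 1)"
      using insert_max_permutes by (auto simp: Sn_def)
    show "card (?f ` ({0..n} \<times> Sn n)) = card (Sn (n + 1))"
      by (simp add: card_image[OF inj_on_insert_max] card card_cartesian_product)
  qed (rule fin)
  with inj_on_insert_max show ?thesis by (simp add: bij_betw_def)
qed

text \<open>\<open>skip_pos k\<close> preserves the order of the old positions and their letters are
  unchanged, so old pairs keep their status. The new letter exceeds all others: it is the right end
  of a non-inversion with every position before it and the left end of none.\<close>

lemma noninversions_insert_max:
  assumes \<pi>: "\<pi> permutes {1..n}" and k: "k \<le> n"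
  shows "noninversions (n + 1) (insert_max n k \<pi>) =
    map_prod (skip_pos k) (skip_pos k) ` noninversions n \<pi> \<union> (\<lambda>i. (i, k + 1)) ` {1..k}"
    (is "_ = ?A \<union> ?B")
proof (rule set_eqI, clarify)
  fix a b
  let ?\<sigma> = "insert_max n k \<pi>"
  note old = insert_max_skip_pos[of _ n k \<pi>]
  note new = insert_max_new[OF \<pi>, of k]
  have le: "\<pi> j \<le> n" if "j \<in> {1..n}" for j
    using permutes_in_image[OF \<pi>] that by fastforce
  have range: "skip_pos k j \<in> {1..n + 1}" if "j \<in> {1..n}" for j
    using that by (auto simp: skip_pos_def)
  show "(a, b) \<in> noninversions (n + 1) ?\<sigma> \<longleftrightarrow> (a, b) \<in> ?A \<union> ?B"
  proof
    assume "(a, b) \<in> noninversions (n + 1) ?\<sigma>"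
    then have ab: "a \<in> {1..n + 1}" "b \<in> {1..n + 1}" "a < b" "?\<sigma> a < ?\<sigma> b"
      by (auto simp: noninversions_def)
    from ab(2) k show "(a, b) \<in> ?A \<union> ?B"
    proof (cases rule: skip_pos_cases)
      case 1
      then show ?thesis using ab by auto
    next
      case (2 j)
      from ab(1) k show ?thesis
      proof (cases rule: skip_pos_cases)
        case 1
        \<comment> \<open>This case is contradictory: the left position would carry the maximum
          \<open>n + 1\<close>, while the right one carries \<open>\<pi> j \<le> n\<close>.\<close>
        then show ?thesis using 2 ab(4) new old le by fastforce
      next
        case (2 i)
        then show ?thesis using \<open>j \<in> {1..n}\<close> \<open>b = skip_pos k j\<close> ab old
          by (auto simp: noninversions_def skip_pos_less_iff intro!: image_eqI[of _ _ "(i, j)"])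
      qed
    qed
  next
    assume "(a, b) \<in> ?A \<union> ?B"
    then show "(a, b) \<in> noninversions (n + 1) ?\<sigma>"
    proof
      assume "(a, b) \<in> ?A"
      then obtain i j where "a = skip_pos k i" "b = skip_pos k j" "i \<in> {1..n}" "j \<in> {1..n}"
        "i < j" "\<pi> i < \<pi> j"
        by (auto simp: noninversions_def)
      then show ?thesis
        using old range[of i] range[of j] by (auto simp: noninversions_def skip_pos_less_iff)
    next
      assume "(a, b) \<in> ?B"
      then have a: "a \<in> {1..k}" and b: "b = k + 1" by auto
      then have "?\<sigma> a = \<pi> a" using old[of a] k by (auto simp: skip_pos_def)
      then show ?thesis using a b k new le[of a] by (auto simp: noninversions_def)
    qed
  qed
qed

lemma finite_noninversions: "finite (noninversions n \<pi>)"
  by (rule finite_subset[of _ "{1..n} \<times> {1..n}"]) (auto simp: noninversions_def)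

lemma ninvsum_insert_max:
  assumes \<pi>: "\<pi> permutes {1..n}" and k: "k \<le> n"
  shows "ninvsum (n + 1) (insert_max n k \<pi>) =
    (k + 1 choose 2) + zone_crossing n \<pi> k + ninvsum n \<pi>"
proof -
  let ?N = "noninversions n \<pi>" and ?s = "map_prod (skip_pos k) (skip_pos k)"
  \<comment> \<open>Second components separate the two families, since \<open>skip_pos k\<close>
    never takes the value \<open>k + 1\<close>.\<close>
  have disj: "?s ` ?N \<inter> (\<lambda>i. (i, k + 1)) ` {1..k} = {}"
    by (auto simp: skip_pos_def split: if_splits)
  have inj: "inj_on ?s ?N"
    by (rule inj_on_subset[OF prod.inj_map[OF inj_skip_pos inj_skip_pos] subset_UNIV])
  have "(\<Sum>(a, b)\<in>?s ` ?N. b - a) =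
      (\<Sum>(a, b)\<in>?N. (b - a) + (if a \<le> k \<and> k < b then 1 else 0))"
    unfolding sum.reindex[OF inj]
    by (rule sum.cong) (auto simp: noninversions_def skip_pos_diff)
  \<comment> \<open>The unit stretches of the straddling pairs are collected in an indicator sum,
    which counts exactly the pairs crossing zone \<open>k\<close>.\<close>
  also have "\<dots> = ninvsum n \<pi> + (\<Sum>x\<in>?N. if fst x \<le> k \<and> k < snd x then 1 else 0)"
    by (simp add: ninvsum_def sum.distrib case_prod_unfold)
  also have "(\<Sum>x\<in>?N. if fst x \<le> k \<and> k < snd x then 1 else 0) = zone_crossing n \<pi> k"
    by (simp add: zone_crossing_def sum.If_cases finite_noninversions Int_def case_prod_unfold)
  finally have old: "(\<Sum>(a, b)\<in>?s ` ?N. b - a) = ninvsum n \<pi> + zone_crossing n \<pi> k" .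
  have "(\<Sum>(a, b)\<in>(\<lambda>i. (i, k + 1)) ` {1..k}. b - a) = (\<Sum>i = 1..k. k + 1 - i)"
    by (subst sum.reindex) (auto simp: inj_on_def)
  also have "\<dots> = \<Sum>{1..k}"
    by (subst sum.atLeastAtMost_rev) simp
  also have "\<dots> = (k + 1 choose 2)"
    by (induction k) (auto simp: numeral_2_eq_2)
  finally have new: "(\<Sum>(a, b)\<in>(\<lambda>i. (i, k + 1)) ` {1..k}. b - a) = (k + 1 choose 2)" .
  show ?thesis
    unfolding ninvsum_def[of "n + 1"] noninversions_insert_max[OF assms]
    by (subst sum.union_disjoint) (use disj old new finite_noninversions in auto)
qed

lemma zone_crossing_eq_0: "k = 0 \<or> n \<le> k \<Longrightarrow> zone_crossing n \<pi> k = 0"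
  unfolding zone_crossing_def card_eq_0_iff by (rule disjI1) (auto simp: noninversions_def)

text \<open>No non-inversion has \<open>a \<le> 0\<close> or \<open>b > n\<close>, so the padding
  zeros are the values that \<open>zone_crossing\<close> already takes there. The boundary terms of
  the recurrence can thus be treated like all others.\<close>

lemma aug_zone_crossing_eq: "aug_zone_crossing n \<pi> k = zone_crossing n \<pi> k"
  using zone_crossing_eq_0[of k n \<pi>] by (auto simp: aug_zone_crossing_def)

theorem theorem3p8:
  fixes n :: nat
  assumes "n \<ge> 1"
  shows "ninvsum_poly (n + 1) =
           (\<Sum>k = 0..n. qvar ^ ((k + 1) choose 2) *
              (\<Sum>\<pi> \<in> Sn n. qvar ^ aug_zone_crossing n \<pi> k * qvar ^ ninvsum n \<pi>))
       \<and> (\<Sum>k = 0..n. qvar ^ ((k + 1) choose 2) *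
              (\<Sum>\<pi> \<in> Sn n. qvar ^ aug_zone_crossing n \<pi> k * qvar ^ ninvsum n \<pi>)) =
           ninvsum_poly n
           + (\<Sum>k = 1..n - 1. qvar ^ ((k + 1) choose 2) *
                (\<Sum>\<pi> \<in> Sn n. qvar ^ zone_crossing n \<pi> k * qvar ^ ninvsum n \<pi>))
           + qvar ^ ((n + 1) choose 2) * ninvsum_poly n"
proof
  have "ninvsum_poly (n + 1) =
      (\<Sum>(k, \<pi>)\<in>{0..n} \<times> Sn n. qvar ^ ninvsum (n + 1) (insert_max n k \<pi>))"
    unfolding ninvsum_poly_def sum.reindex_bij_betw[OF bij_betw_insert_max, symmetric]
    by (simp add: case_prod_unfold)
  also have "\<dots> = (\<Sum>k = 0..n. \<Sum>\<pi> \<in> Sn n. qvar ^ ninvsum (n + 1) (insert_max n k \<pi>))"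
    by (rule sum.cartesian_product[symmetric])
  also have "\<dots> = (\<Sum>k = 0..n. qvar ^ ((k + 1) choose 2) *
      (\<Sum>\<pi> \<in> Sn n. qvar ^ aug_zone_crossing n \<pi> k * qvar ^ ninvsum n \<pi>))"
    unfolding sum_distrib_left
  proof (intro sum.cong refl)
    fix k \<pi> assume "k \<in> {0..n}" "\<pi> \<in> Sn n"
    then have "\<pi> permutes {1..n}" "k \<le> n" by (auto simp: Sn_def)
    from ninvsum_insert_max[OF this]
    show "qvar ^ ninvsum (n + 1) (insert_max n k \<pi>) =
        qvar ^ ((k + 1) choose 2) * (qvar ^ aug_zone_crossing n \<pi> k * qvar ^ ninvsum n \<pi>)"
      by (simp only: aug_zone_crossing_eq power_add mult.assoc)
  qed
  finally show "ninvsum_poly (n + 1) = \<dots>" .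
next
  let ?g = "\<lambda>k. qvar ^ ((k + 1) choose 2) *
      (\<Sum>\<pi> \<in> Sn n. qvar ^ zone_crossing n \<pi> k * qvar ^ ninvsum n \<pi>)"
  have "{0..n} = insert 0 (insert n {1..n - 1})" using assms by auto
  \<comment> \<open>By \<open>n \<ge> 1\<close> the indices 0 and \<open>n\<close> are distinct, so
    two separate boundary terms split off; for \<open>n = 0\<close> they would be one and the same
    summand.\<close>
  then have "sum ?g {0..n} = ?g 0 + sum ?g {1..n - 1} + ?g n"
    using assms by (simp add: add_ac)
  also have "?g 0 = ninvsum_poly n"
    by (simp add: zone_crossing_eq_0 ninvsum_poly_def numeral_2_eq_2)
  also have "?g n = qvar ^ ((n + 1) choose 2) * ninvsum_poly n"
    by (simp add: zone_crossing_eq_0 ninvsum_poly_def)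
  finally show "(\<Sum>k = 0..n. qvar ^ ((k + 1) choose 2) *
      (\<Sum>\<pi> \<in> Sn n. qvar ^ aug_zone_crossing n \<pi> k * qvar ^ ninvsum n \<pi>)) =
      ninvsum_poly n + sum ?g {1..n - 1} + qvar ^ ((n + 1) choose 2) * ninvsum_poly n"
    by (simp only: aug_zone_crossing_eq)
qed

end
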